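(* Let $\mu$ be a Borel probability measure on a bounded metric space $X$. For any dimension function $\Phi$, $$\underline{\dim}_\Phi\mu\le\inf_{z\in\mathrm{supp}\,\mu}\underline{\dim}_{\mathrm{loc}}\mu(z)\le\dim_H\mu\le\sup_{z\in\mathrm{supp}\,\mu}\overline{\dim}_{\mathrm{loc}}\mu(z)\le\overline{\dim}_\Phi\mu.$$
   Context: A dimension function is a map $\Phi:(0,1)\to[0,\infty)$ such that $x^{1+\Phi(x)}$ decreases to $0$ as $x$ decreases to $0$. $B(x,R)$ is the open ball of centre $x$ and radius $R$. $\overline{\dim}_\Phi\mu$ is the infimum of all $\alpha$ for which there exist $C_1,C_2>0$ such that for all $0<r<R^{1+\Phi(R)}\le R\le C_1$ and all $x\in\mathrm{supp}\,\mu$, $\mu(B(x,R))/\mu(B(x,r))\le C_2(R/r)^\alpha$; $\underline{\dim}_\Phi\mu$ is the supremum of all $\alpha$ for which there exist $C_1,C_2>0$ such that for the same $r,R,x$, $\mu(B(x,R))/\mu(B(x,r))\ge C_2(R/r)^\alpha$. Values in $[0,\infty]$ are allowed. For $z\in\mathrm{supp}\,\mu$, $\underline{\dim}_{\mathrm{loc}}\mu(z)=\liminf_{r\to0}\frac{\log\mu(B(z,r))}{\log r}$ and $\overline{\dim}_{\mathrm{loc}}\mu(z)=\limsup_{r\to0}\frac{\log\mu(B(z,r))}{\log r}$. $\dim_H\mu=\inf\{\dim_H F: F \text{ Borel},\ \mu(F)>0\}$ is the Hausdorff dimension of the measure $\mu$.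
   Formalization: The measure μ is assumed to be carried by its support (the complement of supp μ is null); this is automatic on separable X, but on a non-separable X supp μ could be empty (given a real-valued measurable cardinal) and the third inequality would then fail. *)

theory Defs
  imports "HOL-Probability.Probability"
begin

text \<open>"Decreases to 0" is read as (weakly) monotone with limit 0; values of \<open>\<Phi>\<close> outside
  \<open>(0,1)\<close> are irrelevant.\<close>

definition dimension_function :: "(real \<Rightarrow> real) \<Rightarrow> bool" where
  "dimension_function \<Phi> \<longleftrightarrow>
     (\<forall>x\<in>{0<..<1}. 0 \<le> \<Phi> x) \<and>
     mono_on {0<..<1} (\<lambda>x. x powr (1 + \<Phi> x)) \<and>
     ((\<lambda>x. x powr (1 + \<Phi> x)) \<longlongrightarrow> 0) (at_right 0)"

definition msupport :: "'a::metric_space measure \<Rightarrow> 'a set" where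
  "msupport M = {x. \<forall>r>0. 0 < emeasure M (ball x r)}"

text \<open>The condition \<open>R < 1\<close> below keeps \<open>R\<close> in the domain of \<open>\<Phi>\<close>.
  The exponents \<open>\<alpha>\<close> range over all reals; when the support is nonempty both
  dimensions are automatically nonnegative.\<close>

definition upper_Phi_exponent :: "(real \<Rightarrow> real) \<Rightarrow> 'a::metric_space measure \<Rightarrow> real \<Rightarrow> bool" where
  "upper_Phi_exponent \<Phi> M \<alpha> \<longleftrightarrow>
     (\<exists>C1>0. \<exists>C2>0. \<forall>r R. \<forall>x\<in>msupport M.
        0 < r \<and> r < R powr (1 + \<Phi> R) \<and> R powr (1 + \<Phi> R) \<le> R \<and> R \<le> C1 \<and> 0 < R \<and> R < 1 \<longrightarrow>
          measure M (ball x R) / measure M (ball x r) \<le> C2 * (R / r) powr \<alpha>)"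

definition lower_Phi_exponent :: "(real \<Rightarrow> real) \<Rightarrow> 'a::metric_space measure \<Rightarrow> real \<Rightarrow> bool" where
  "lower_Phi_exponent \<Phi> M \<alpha> \<longleftrightarrow>
     (\<exists>C1>0. \<exists>C2>0. \<forall>r R. \<forall>x\<in>msupport M.
        0 < r \<and> r < R powr (1 + \<Phi> R) \<and> R powr (1 + \<Phi> R) \<le> R \<and> R \<le> C1 \<and> 0 < R \<and> R < 1 \<longrightarrow>
          measure M (ball x R) / measure M (ball x r) \<ge> C2 * (R / r) powr \<alpha>)"

definition upper_Phi_dim :: "(real \<Rightarrow> real) \<Rightarrow> 'a::metric_space measure \<Rightarrow> ereal" where
  "upper_Phi_dim \<Phi> M = (INF \<alpha>\<in>{\<alpha>. upper_Phi_exponent \<Phi> M \<alpha>}. ereal \<alpha>)"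

definition lower_Phi_dim :: "(real \<Rightarrow> real) \<Rightarrow> 'a::metric_space measure \<Rightarrow> ereal" where
  "lower_Phi_dim \<Phi> M = (SUP \<alpha>\<in>{\<alpha>. lower_Phi_exponent \<Phi> M \<alpha>}. ereal \<alpha>)"

definition lower_local_dim :: "'a::metric_space measure \<Rightarrow> 'a \<Rightarrow> ereal" where
  "lower_local_dim M z = Liminf (at_right 0) (\<lambda>r. ereal (ln (measure M (ball z r)) / ln r))"

definition upper_local_dim :: "'a::metric_space measure \<Rightarrow> 'a \<Rightarrow> ereal" where
  "upper_local_dim M z = Limsup (at_right 0) (\<lambda>r. ereal (ln (measure M (ball z r)) / ln r))"

text \<open>\<open>diam(U)\<^sup>s\<close> with the usual conventions for Hausdorff measures (the empty set contributes
  0, and \<open>0\<^sup>0 = 1\<close>, whereas \<open>0 powr 0 = 0\<close>), so that the 0-dimensional Hausdorff measure is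
  counting measure.\<close>

definition diam_power :: "real \<Rightarrow> 'a::metric_space set \<Rightarrow> real" where
  "diam_power s U = (if U = {} then 0 else if s = 0 then 1 else diameter U powr s)"

definition hausdorff_content :: "real \<Rightarrow> real \<Rightarrow> 'a::metric_space set \<Rightarrow> ennreal" where
  "hausdorff_content s \<delta> F =
     (INF U\<in>{U :: nat \<Rightarrow> 'a set. F \<subseteq> (\<Union>i. U i) \<and> (\<forall>i. bounded (U i) \<and> diameter (U i) \<le> \<delta>)}.
        \<Sum>i. ennreal (diam_power s (U i)))"

definition hausdorff_measure :: "real \<Rightarrow> 'a::metric_space set \<Rightarrow> ennreal" where
  "hausdorff_measure s F = (SUP \<delta>\<in>{0<..}. hausdorff_content s \<delta> F)"

text \<open>The value is \<open>\<infinity>\<close> if no \<open>s\<close> qualifies.\<close>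

definition hausdorff_dim :: "'a::metric_space set \<Rightarrow> ereal" where
  "hausdorff_dim F = (INF s\<in>{s. 0 \<le> s \<and> hausdorff_measure s F = 0}. ereal s)"

definition measure_hausdorff_dim :: "'a::metric_space measure \<Rightarrow> ereal" where
  "measure_hausdorff_dim M = (INF F\<in>{F \<in> sets M. 0 < emeasure M F}. hausdorff_dim F)"

text \<open>On a separable space every Borel measure is carried by its support. On a non-separable space
  this is an additional property, without which the support may even be empty.\<close>

lemma emeasure_compl_msupport:
  fixes M :: "'a::{metric_space, second_countable_topology} measure"
  assumes "sets M = sets borel"
  shows "emeasure M (- msupport M) = 0"
proof -
  define \<F> where "\<F> = {ball x r | x r. r > 0 \<and> emeasure M (ball x r) = 0}"
  obtain \<F>' where F': "\<F>' \<subseteq> \<F>" "countable \<F>'" "\<Union>\<F>' = \<Union>\<F>"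
    by (rule Lindelof[of \<F>]) (auto simp: \<F>_def)
  have "\<F>' \<subseteq> null_sets M"
    using F'(1) assms by (auto simp: \<F>_def null_sets_def)
  then have "\<Union>\<F>' \<in> null_sets M"
    using F'(2) null_sets_UN'[of \<F>' "\<lambda>x. x" M] by auto
  moreover have "- msupport M \<subseteq> \<Union>\<F>"
  proof
    fix x assume "x \<in> - msupport M"
    then obtain r where "r > 0" "emeasure M (ball x r) = 0"
      by (auto simp: msupport_def)
    then show "x \<in> \<Union>\<F>"
      unfolding \<F>_def by (intro UnionI[of "ball x r"]) auto
  qed
  ultimately show ?thesis
    by (metis F'(3) emeasure_mono le_zero_eq null_setsD1 null_setsD2)
qed

end

theory Submission
  imports Defs
begin

text \<open>The two outer inequalities and the two inner ones hold for different reasons.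

  If \<open>\<alpha>\<close> is an exponent admissible for one of the \<open>\<Phi>\<close>-dimensions, one freezes a
  single radius \<open>R\<close> and lets \<open>r\<close> tend to 0. Since \<open>R\<close> is constant, the defining inequality
  becomes a power bound \<open>\<mu>(B(z,r)) \<le> c r\<^sup>\<alpha>\<close> (or \<open>\<ge>\<close>), and taking logarithms makes the constant
  disappear in the limit: \<open>\<alpha>\<close> bounds the local dimension at every point of the support
  (\<open>lower_Phi_exponent_le_local_dim\<close>, \<open>local_dim_le_upper_Phi_exponent\<close>).

  The inner inequalities are Billingsley-type comparisons. If all lower local dimensions exceed
  \<open>t > s\<close> and \<open>\<mu>(F) > 0\<close>, then \<open>F\<close> has a piece of positive mass on which \<open>\<mu>(B(z,r)) \<le> r\<^sup>t\<close> holds below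
  a uniform scale; every fine cover of that piece must account for its mass, so the
  \<open>s\<close>-dimensional Hausdorff measure of \<open>F\<close> does not vanish (\<open>mass_distribution\<close>). If all upper local
  dimensions are below \<open>t < s\<close>, the support is a countable union of pieces on which
  \<open>\<mu>(B(z,r)) \<ge> r\<^sup>t\<close> below a uniform scale; only about \<open>r\<^sup>-\<^sup>t\<close> disjoint \<open>r\<close>-balls with centres in
  such a piece fit into the total mass, so it has covers of cost about \<open>r\<^sup>s\<^sup>-\<^sup>t\<close>, which tends to 0
  (\<open>hausdorff_content_eq_0_of_mass_lower_bound\<close>). As the support itself has positive mass, its
  Hausdorff dimension bounds that of \<open>\<mu>\<close> from above.

  The nets used in the second comparison are finite because the total mass is, not because of
  any compactness or separability of the space.\<close>

section \<open>Local dimensions and power bounds on ball masses\<close>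

lemma measure_ball_pos:
  assumes "finite_measure M" "z \<in> msupport M" "0 < r"
  shows "0 < measure M (ball z r)"
proof -
  interpret finite_measure M by fact
  show ?thesis
    using assms(2,3) by (auto simp: msupport_def emeasure_eq_measure)
qed

lemma tendsto_add_const_div_ln:
  "((\<lambda>r. ereal (\<alpha> + c / ln r)) \<longlongrightarrow> ereal \<alpha>) (at_right (0::real))"
proof -
  have "((\<lambda>r. c / ln r) \<longlongrightarrow> 0) (at_right (0::real))"
    by (intro tendsto_divide_0[OF tendsto_const]
        filterlim_mono[OF ln_at_0 at_bot_le_at_infinity order_refl])
  then have "((\<lambda>r. \<alpha> + c / ln r) \<longlongrightarrow> \<alpha> + 0) (at_right (0::real))"
    by (intro tendsto_add tendsto_const)
  then show ?thesis by simp
qed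

text \<open>Multiplying a power by a constant changes \<open>ln (f r) / ln r\<close> only by \<open>ln c / ln r\<close>, which tends
  to 0. Inequalities are reversed on division because \<open>ln r < 0\<close> near 0.\<close>

lemma le_Liminf_ln_ratio:
  assumes "\<And>r. 0 < r \<Longrightarrow> 0 < f r" "0 < c"
    and "\<forall>\<^sub>F r in at_right (0::real). f r \<le> c * r powr \<alpha>"
  shows "ereal \<alpha> \<le> Liminf (at_right 0) (\<lambda>r. ereal (ln (f r) / ln r))"
proof -
  have "\<forall>\<^sub>F r in at_right (0::real). 0 < r \<and> r < 1"
    by (auto simp: eventually_at_right_field intro!: exI[of _ 1])
  with assms(3) have "\<forall>\<^sub>F r in at_right 0. ereal (\<alpha> + ln c / ln r) \<le> ereal (ln (f r) / ln r)"
  proof eventually_elim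
    case (elim r)
    then have "ln (f r) \<le> ln (c * r powr \<alpha>)"
      using assms(1)[of r] by (intro ln_mono) auto
    then have "ln (f r) \<le> ln c + \<alpha> * ln r"
      using elim assms(2) by (simp add: ln_mult ln_powr)
    moreover have r: "ln r < 0"
      using elim by simp
    ultimately have "(ln c + \<alpha> * ln r) / ln r \<le> ln (f r) / ln r"
      by (intro divide_right_mono_neg) auto
    then show ?case
      using r by (simp add: add_divide_distrib)
  qed
  then have "Liminf (at_right 0) (\<lambda>r. ereal (\<alpha> + ln c / ln r))
      \<le> Liminf (at_right 0) (\<lambda>r. ereal (ln (f r) / ln r))"
    by (rule Liminf_mono)
  then show ?thesis
    using lim_imp_Liminf[OF _ tendsto_add_const_div_ln[of \<alpha> "ln c"]] by simp
qed

lemma Limsup_ln_ratio_le: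
  assumes "0 < c" and "\<forall>\<^sub>F r in at_right (0::real). c * r powr \<alpha> \<le> f r"
  shows "Limsup (at_right 0) (\<lambda>r. ereal (ln (f r) / ln r)) \<le> ereal \<alpha>"
proof -
  have "\<forall>\<^sub>F r in at_right (0::real). 0 < r \<and> r < 1"
    by (auto simp: eventually_at_right_field intro!: exI[of _ 1])
  with assms(2) have "\<forall>\<^sub>F r in at_right 0. ereal (ln (f r) / ln r) \<le> ereal (\<alpha> + ln c / ln r)"
  proof eventually_elim
    case (elim r)
    then have "ln (c * r powr \<alpha>) \<le> ln (f r)"
      using assms(1) by (intro ln_mono) auto
    then have "ln c + \<alpha> * ln r \<le> ln (f r)"
      using elim assms(1) by (simp add: ln_mult ln_powr)
    moreover have r: "ln r < 0"
      using elim by simp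
    ultimately have "ln (f r) / ln r \<le> (ln c + \<alpha> * ln r) / ln r"
      by (intro divide_right_mono_neg) auto
    then show ?case
      using r by (simp add: add_divide_distrib)
  qed
  then have "Limsup (at_right 0) (\<lambda>r. ereal (ln (f r) / ln r))
      \<le> Limsup (at_right 0) (\<lambda>r. ereal (\<alpha> + ln c / ln r))"
    by (rule Limsup_mono)
  then show ?thesis
    using lim_imp_Limsup[OF _ tendsto_add_const_div_ln[of \<alpha> "ln c"]] by simp
qed

text \<open>A strict inequality between \<open>t\<close> and the local dimension passes to \<open>ln \<mu>(B(z,r)) / ln r\<close> at all
  small scales, so the power bound comes without a multiplicative constant. This lemma and the next
  are the form in which local dimensions enter the covering arguments.\<close>

lemma measure_ball_le_powr:
  assumes "finite_measure M" "z \<in> msupport M" "ereal t < lower_local_dim M z"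
  shows "\<exists>b>0. \<forall>r. 0 < r \<and> r < b \<longrightarrow> measure M (ball z r) \<le> r powr t"
proof -
  have "\<forall>\<^sub>F r in at_right (0::real). 0 < r \<and> r < 1"
    by (auto simp: eventually_at_right_field intro!: exI[of _ 1])
  with less_LiminfD[OF assms(3)[unfolded lower_local_dim_def]]
  have "\<forall>\<^sub>F r in at_right 0. measure M (ball z r) \<le> r powr t"
  proof eventually_elim
    case (elim r)
    then have "ln (measure M (ball z r)) < t * ln r"
      by (simp add: field_simps)
    then show ?case
      using measure_ball_pos[OF assms(1,2), of r] elim
      by (metis less_imp_le ln_powr ln_less_cancel_iff powr_gt_zero less_irrefl)
  qed
  then show ?thesis
    by (auto simp: eventually_at_right_field)
qed

lemma powr_le_measure_ball:
  assumes "finite_measure M" "z \<in> msupport M" "upper_local_dim M z < ereal t"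
  shows "\<exists>b>0. \<forall>r. 0 < r \<and> r < b \<longrightarrow> r powr t \<le> measure M (ball z r)"
proof -
  have "\<forall>\<^sub>F r in at_right (0::real). 0 < r \<and> r < 1"
    by (auto simp: eventually_at_right_field intro!: exI[of _ 1])
  with Limsup_lessD[OF assms(3)[unfolded upper_local_dim_def]]
  have "\<forall>\<^sub>F r in at_right 0. r powr t \<le> measure M (ball z r)"
  proof eventually_elim
    case (elim r)
    then have "t * ln r < ln (measure M (ball z r))"
      by (simp add: field_simps)
    then show ?case
      using measure_ball_pos[OF assms(1,2), of r] elim
      by (metis less_imp_le ln_powr ln_less_cancel_iff powr_gt_zero less_irrefl)
  qed
  then show ?thesis
    by (auto simp: eventually_at_right_field)
qed

text \<open>For a probability measure \<open>\<mu>(B(z,r)) \<le> 1 = r\<^sup>0\<close>, which is a power bound with exponent 0.\<close>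

lemma upper_local_dim_nonneg:
  assumes "prob_space M" "z \<in> msupport M"
  shows "0 \<le> upper_local_dim M z"
proof -
  interpret prob_space M by fact
  have "ereal 0 \<le> Liminf (at_right 0) (\<lambda>r. ereal (ln (measure M (ball z r)) / ln r))"
    using measure_ball_pos[OF finite_measure_axioms assms(2)]
    by (intro le_Liminf_ln_ratio[where c = 1])
       (auto simp: eventually_at_right_field intro!: exI[of _ 1])
  also have "\<dots> \<le> upper_local_dim M z"
    unfolding upper_local_dim_def by (rule Liminf_le_Limsup) simp
  finally show ?thesis
    by (simp add: zero_ereal_def)
qed

section \<open>Comparison of local dimensions with the \<open>\<Phi>\<close>-dimensions\<close>

text \<open>For a given \<open>R\<close> the defining inequalities of the \<open>\<Phi>\<close>-dimensions speak about all \<open>r\<close> below the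
  positive threshold \<open>R powr (1 + \<Phi> R)\<close>; this is what allows \<open>R\<close> to stay fixed while \<open>r\<close> tends to 0.\<close>

lemma small_scale_exists:
  assumes "dimension_function \<Phi>" "0 < C"
  obtains R where "0 < R" "R < 1" "R \<le> C" "R powr (1 + \<Phi> R) \<le> R" "0 < R powr (1 + \<Phi> R)"
proof -
  define R where "R = min C (1/2)"
  have R: "0 < R" "R < 1" "R \<le> C"
    using assms(2) by (auto simp: R_def)
  then have "0 \<le> \<Phi> R"
    using assms(1) by (auto simp: dimension_function_def)
  then have "R powr (1 + \<Phi> R) \<le> R powr 1"
    using R by (intro powr_mono') auto
  then show ?thesis
    using that R by auto
qed

text \<open>For fixed \<open>R\<close>, the defining inequality solved for \<open>\<mu>(B(z,r))\<close> is a power bound with constant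
  \<open>\<mu>(B(z,R)) / (C2 R\<^sup>\<alpha>)\<close>, positive because \<open>z\<close> lies in the support.\<close>

lemma lower_Phi_exponent_le_local_dim:
  assumes "finite_measure M" "dimension_function \<Phi>" "z \<in> msupport M" "lower_Phi_exponent \<Phi> M \<alpha>"
  shows "ereal \<alpha> \<le> lower_local_dim M z"
proof -
  obtain C1 C2 where C: "0 < C1" "0 < C2" and
    bound: "\<And>r R x. x \<in> msupport M \<Longrightarrow>
      0 < r \<and> r < R powr (1 + \<Phi> R) \<and> R powr (1 + \<Phi> R) \<le> R \<and> R \<le> C1 \<and> 0 < R \<and> R < 1 \<Longrightarrow>
      C2 * (R / r) powr \<alpha> \<le> measure M (ball x R) / measure M (ball x r)"
    using assms(4) unfolding lower_Phi_exponent_def by blast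
  obtain R where R: "0 < R" "R < 1" "R \<le> C1" "R powr (1 + \<Phi> R) \<le> R" "0 < R powr (1 + \<Phi> R)"
    using small_scale_exists[OF assms(2) C(1)] .
  note pos = measure_ball_pos[OF assms(1,3)]
  have "measure M (ball z r) \<le> measure M (ball z R) / (C2 * R powr \<alpha>) * r powr \<alpha>"
    if "0 < r" "r < R powr (1 + \<Phi> R)" for r
  proof -
    have "C2 * (R / r) powr \<alpha> \<le> measure M (ball z R) / measure M (ball z r)"
      using bound[OF assms(3), of r R] that R by blast
    then show ?thesis
      using that R C pos[of r] by (simp add: powr_divide field_simps)
  qed
  then have "\<forall>\<^sub>F r in at_right 0. measure M (ball z r) \<le> measure M (ball z R) / (C2 * R powr \<alpha>) * r powr \<alpha>"
    using R(5) by (auto simp only: eventually_at_right_field)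
  moreover have "0 < measure M (ball z R) / (C2 * R powr \<alpha>)"
    using pos[OF R(1)] R(1) C(2) by simp
  ultimately show ?thesis
    unfolding lower_local_dim_def using pos by (intro le_Liminf_ln_ratio)
qed

lemma local_dim_le_upper_Phi_exponent:
  assumes "finite_measure M" "dimension_function \<Phi>" "z \<in> msupport M" "upper_Phi_exponent \<Phi> M \<alpha>"
  shows "upper_local_dim M z \<le> ereal \<alpha>"
proof -
  obtain C1 C2 where C: "0 < C1" "0 < C2" and
    bound: "\<And>r R x. x \<in> msupport M \<Longrightarrow>
      0 < r \<and> r < R powr (1 + \<Phi> R) \<and> R powr (1 + \<Phi> R) \<le> R \<and> R \<le> C1 \<and> 0 < R \<and> R < 1 \<Longrightarrow>
      measure M (ball x R) / measure M (ball x r) \<le> C2 * (R / r) powr \<alpha>"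
    using assms(4) unfolding upper_Phi_exponent_def by blast
  obtain R where R: "0 < R" "R < 1" "R \<le> C1" "R powr (1 + \<Phi> R) \<le> R" "0 < R powr (1 + \<Phi> R)"
    using small_scale_exists[OF assms(2) C(1)] .
  note pos = measure_ball_pos[OF assms(1,3)]
  have "measure M (ball z R) / (C2 * R powr \<alpha>) * r powr \<alpha> \<le> measure M (ball z r)"
    if "0 < r" "r < R powr (1 + \<Phi> R)" for r
  proof -
    have "measure M (ball z R) / measure M (ball z r) \<le> C2 * (R / r) powr \<alpha>"
      using bound[OF assms(3), of r R] that R by blast
    then show ?thesis
      using that R C pos[of r] by (simp add: powr_divide field_simps)
  qed
  then have "\<forall>\<^sub>F r in at_right 0. measure M (ball z R) / (C2 * R powr \<alpha>) * r powr \<alpha> \<le> measure M (ball z r)"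
    using R(5) by (auto simp only: eventually_at_right_field)
  moreover have "0 < measure M (ball z R) / (C2 * R powr \<alpha>)"
    using pos[OF R(1)] R(1) C(2) by simp
  ultimately show ?thesis
    unfolding upper_local_dim_def using pos by (intro Limsup_ln_ratio_le)
qed

section \<open>Lower bounds for Hausdorff dimension\<close>

lemma closed_msupport:
  assumes "sets M = sets borel"
  shows "closed (msupport M)"
proof -
  have "\<exists>e>0. ball x e \<subseteq> - msupport M" if x: "x \<in> - msupport M" for x
  proof -
    obtain r where r: "0 < r" "emeasure M (ball x r) = 0"
      using x by (auto simp: msupport_def)
    have "y \<notin> msupport M" if y: "y \<in> ball x r" for y
    proof -
      obtain e where "0 < e" "ball y e \<subseteq> ball x r"
        using y by (meson openE open_ball)
      then have "emeasure M (ball y e) \<le> emeasure M (ball x r)"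
        using assms by (intro emeasure_mono) auto
      with r \<open>0 < e\<close> show ?thesis
        by (auto simp: msupport_def)
    qed
    with r show ?thesis by auto
  qed
  then have "open (- msupport M)"
    by (subst open_contains_ball) blast
  then show ?thesis
    by (simp add: closed_def)
qed

text \<open>The map \<open>z \<mapsto> \<mu>(B(z,r))\<close> is lower semicontinuous: if \<open>B(z,r)\<close> has mass above \<open>c\<close>, then so does a
  slightly smaller concentric ball, and this one is contained in \<open>B(y,r)\<close> for \<open>y\<close> near \<open>z\<close>.
  Closedness is what makes the pieces of uniform decay Borel sets.\<close>

lemma closed_measure_ball_le:
  fixes M :: "'a::metric_space measure"
  assumes "finite_measure M" "sets M = sets borel"
  shows "closed {z. measure M (ball z r) \<le> c}"
proof -
  interpret finite_measure M by fact
  have "\<exists>e>0. ball z e \<subseteq> {z. c < measure M (ball z r)}" if z: "c < measure M (ball z r)" for z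
  proof -
    \<comment> \<open>Open balls are increasing unions of smaller balls, so continuity from below applies.\<close>
    let ?B = "\<lambda>n. ball z (r - 1 / Suc n)"
    have "ball z r \<subseteq> (\<Union>n. ?B n)"
    proof
      fix y assume "y \<in> ball z r"
      then obtain n where "inverse (real (Suc n)) < r - dist z y"
        using reals_Archimedean[of "r - dist z y"] by auto
      then show "y \<in> (\<Union>n. ?B n)"
        by (auto simp: inverse_eq_divide intro!: exI[of _ n])
    qed
    moreover have "?B n \<subseteq> ball z r" for n
      by (intro subset_ball) (simp add: field_simps)
    ultimately have eq: "(\<Union>n. ?B n) = ball z r"
      by blast
    have "incseq ?B"
      by (intro incseq_SucI subset_ball) (simp add: field_simps)
    moreover have "range ?B \<subseteq> sets M"
      unfolding assms(2) by (intro image_subsetI borel_open open_ball)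
    ultimately have "(\<lambda>n. measure M (?B n)) \<longlonglongrightarrow> measure M (\<Union>n. ?B n)"
      by (intro finite_Lim_measure_incseq)
    then have "(\<lambda>n. measure M (?B n)) \<longlonglongrightarrow> measure M (ball z r)"
      unfolding eq .
    then have "\<forall>\<^sub>F n in sequentially. c < measure M (?B n)"
      using z by (rule order_tendstoD(1))
    then obtain n where n: "c < measure M (?B n)"
      using eventually_happens' sequentially_bot by blast
    have "c < measure M (ball y r)" if y: "y \<in> ball z (1 / Suc n)" for y
    proof -
      have "?B n \<subseteq> ball y r"
      proof
        fix w assume "w \<in> ?B n"
        then show "w \<in> ball y r"
          using y dist_triangle[of y w z] by (simp add: dist_commute)
      qed
      then have "measure M (?B n) \<le> measure M (ball y r)"
        using assms(2) by (intro finite_measure_mono) auto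
      with n show ?thesis by simp
    qed
    then show ?thesis
      by (intro exI[of _ "1 / Suc n"]) auto
  qed
  then have "open {z. c < measure M (ball z r)}"
    by (auto simp: open_contains_ball)
  then show ?thesis
    by (simp add: closed_def Collect_neg_eq[symmetric] not_le)
qed

text \<open>The mass distribution principle. A covering set \<open>U\<close> of positive diameter that meets \<open>A\<close> in a point \<open>z\<close> lies in the
  ball of radius \<open>2 diam(U)\<close> about \<open>z\<close>, whose mass is at most \<open>2\<^sup>t diam(U)\<^sup>t \<le> 2\<^sup>t diam(U)\<^sup>s\<close>; summing over
  the cover bounds the mass of \<open>A\<close>. The covering sets need not be measurable, so each is replaced
  by such a ball. The factor 2 is there because the balls are open.\<close>

lemma mass_distribution:
  fixes M :: "'a::metric_space measure"
  assumes "finite_measure M" "sets M = sets borel" "A \<in> sets M" "A \<subseteq> F"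
    and "0 \<le> s" "s \<le> t" "0 < t" "0 < \<delta>" "\<delta> \<le> 1" "2 * \<delta> < \<rho>"
    and bound: "\<And>z r. z \<in> A \<Longrightarrow> 0 < r \<Longrightarrow> r < \<rho> \<Longrightarrow> measure M (ball z r) \<le> r powr t"
  shows "emeasure M A \<le> ennreal (2 powr t) * hausdorff_content s \<delta> F"
proof -
  interpret finite_measure M by fact
  let ?C = "{U :: nat \<Rightarrow> 'a set. F \<subseteq> (\<Union>i. U i) \<and> (\<forall>i. bounded (U i) \<and> diameter (U i) \<le> \<delta>)}"
  have trap: "\<exists>V\<in>sets M. U \<inter> A \<subseteq> V \<and> emeasure M V \<le> ennreal (2 powr t) * ennreal (diam_power s U)"
    if U: "bounded U" "diameter U \<le> \<delta>" for U
  proof (cases "U \<inter> A = {}")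
    case True
    then show ?thesis by (intro bexI[of _ "{}"]) auto
  next
    case False
    then obtain z where z: "z \<in> U" "z \<in> A" by auto
    define d where "d = diameter U"
    have d: "0 \<le> d" "d \<le> \<delta>"
      using U diameter_ge_0 by (auto simp: d_def)
    have dist: "dist z y \<le> d" if "y \<in> U" for y
      using diameter_bounded_bound[OF U(1) z(1) that] by (simp add: d_def)
    show ?thesis
    proof (cases "d = 0")
      case True
      \<comment> \<open>Here \<open>U = {z}\<close> may have cost 0, so it must have mass 0: letting \<open>r\<close> tend to 0 in the
        decay bound rules out an atom at \<open>z\<close>, because \<open>0 < t\<close>.\<close>
      have "measure M {z} \<le> r powr t" if "0 < r" "r < \<rho>" for r
        using bound[OF z(2) that] finite_measure_mono[of "{z}" "ball z r"] that assms(2) by auto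
      then have "\<forall>\<^sub>F r in at_right 0. measure M {z} \<le> r powr t"
        using assms by (auto simp: eventually_at_right_field intro!: exI[of _ \<rho>])
      moreover have "((\<lambda>r::real. r powr t) \<longlongrightarrow> 0 powr t) (at_right 0)"
        using assms(7) by (intro tendsto_intros) (auto simp: eventually_at_right_field intro!: exI[of _ 1])
      ultimately have "measure M {z} \<le> 0 powr t"
        by (intro tendsto_lowerbound[where F = "at_right 0"]) auto
      then have "emeasure M {z} = 0"
        by (simp add: emeasure_eq_measure measure_le_0_iff)
      moreover have "U \<subseteq> {z}"
        using dist True by fastforce
      ultimately show ?thesis
        using assms(2) by (intro bexI[of _ "{z}"]) auto
    next
      case False
      with d have d0: "0 < d" by simp
      have "measure M (ball z (2 * d)) \<le> (2 * d) powr t"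
        using d d0 assms by (intro bound z) auto
      also have "\<dots> = 2 powr t * d powr t"
        using d by (simp add: powr_mult)
      also have "\<dots> \<le> 2 powr t * d powr s"
        using d d0 assms by (intro mult_left_mono powr_mono') auto
      also have "d powr s = diam_power s U"
        using z d0 by (auto simp: diam_power_def d_def)
      finally have "emeasure M (ball z (2 * d)) \<le> ennreal (2 powr t) * ennreal (diam_power s U)"
        by (simp add: emeasure_eq_measure ennreal_mult'[symmetric] ennreal_leI)
      moreover have "U \<subseteq> ball z (2 * d)"
        using dist d0 by (auto dest!: dist)
      ultimately show ?thesis
        using assms(2) by (intro bexI[of _ "ball z (2 * d)"]) auto
    qed
  qed
  have "emeasure M A \<le> ennreal (2 powr t) * (\<Sum>i. ennreal (diam_power s (U i)))" if U: "U \<in> ?C" for U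
  proof -
    have "\<exists>V\<in>sets M. U i \<inter> A \<subseteq> V \<and>
        emeasure M V \<le> ennreal (2 powr t) * ennreal (diam_power s (U i))" for i
      using U by (intro trap) auto
    then obtain V where V: "\<And>i. V i \<in> sets M" "\<And>i. U i \<inter> A \<subseteq> V i"
      "\<And>i. emeasure M (V i) \<le> ennreal (2 powr t) * ennreal (diam_power s (U i))"
      by metis
    have "emeasure M A \<le> emeasure M (\<Union>i. V i)"
    proof (intro emeasure_mono subsetI)
      fix x assume x: "x \<in> A"
      then obtain i where "x \<in> U i"
        using U assms(4) by blast
      then show "x \<in> (\<Union>i. V i)"
        using V(2) x by blast
    qed (use V(1) in auto)
    also have "\<dots> \<le> (\<Sum>i. emeasure M (V i))"
      using V(1) by (intro emeasure_subadditive_countably) auto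
    also have "\<dots> \<le> (\<Sum>i. ennreal (2 powr t) * ennreal (diam_power s (U i)))"
      using V(3) by (intro suminf_le) auto
    finally show ?thesis by simp
  qed
  then have "emeasure M A / ennreal (2 powr t) \<le> hausdorff_content s \<delta> F"
    unfolding hausdorff_content_def
    by (intro INF_greatest) (simp add: divide_le_posI_ennreal mult.commute)
  then have "ennreal (2 powr t) * (emeasure M A / ennreal (2 powr t))
      \<le> ennreal (2 powr t) * hausdorff_content s \<delta> F"
    by (intro mult_left_mono) auto
  moreover have "ennreal (2 powr t) * (emeasure M A / ennreal (2 powr t)) = emeasure M A"
    by (simp add: ennreal_times_divide mult.commute[of _ "emeasure M A"] mult_divide_eq_ennreal)
  ultimately show ?thesis by simp
qed

text \<open>A positive-mass set of too small Hausdorff dimension \<open>s\<close> would split, up to a null set, into countably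
  many pieces with uniform decay \<open>\<mu>(B(z,r)) \<le> r\<^sup>t\<close>, each of mass 0 by the mass distribution
  principle.\<close>

lemma INF_lower_local_dim_le_hausdorff_dim:
  fixes M :: "'a::metric_space measure"
  assumes "finite_measure M" "sets M = sets borel" "emeasure M (- msupport M) = 0"
    and "F \<in> sets M" "0 < emeasure M F"
  shows "(INF z\<in>msupport M. lower_local_dim M z) \<le> hausdorff_dim F"
  unfolding hausdorff_dim_def
proof (rule INF_greatest, rule ccontr)
  interpret finite_measure M by fact
  fix s assume s: "s \<in> {s. 0 \<le> s \<and> hausdorff_measure s F = 0}"
    and less: "\<not> (INF z\<in>msupport M. lower_local_dim M z) \<le> ereal s"
  then obtain t where t: "ereal s < ereal t" "ereal t < (INF z\<in>msupport M. lower_local_dim M z)"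
    using ereal_dense2 by (meson not_le)
  define E where "E n = {z. \<forall>r\<in>{0<..<1 / Suc n}. measure M (ball z r) \<le> r powr t}" for n
  have "E n = (\<Inter>r\<in>{0<..<1 / Suc n}. {z. measure M (ball z r) \<le> r powr t})" for n
    by (auto simp: E_def)
  then have "closed (E n)" for n
    using closed_measure_ball_le[OF assms(1,2)] by (auto intro!: closed_INT)
  then have E: "E n \<in> sets M" for n
    using assms(2) by auto
  have null: "emeasure M (F \<inter> E n) = 0" for n
  proof -
    define \<delta> where "\<delta> = 1 / (4 * real (Suc n))"
    have "emeasure M (F \<inter> E n) \<le> ennreal (2 powr t) * hausdorff_content s \<delta> F"
      using s t E assms(4)
      by (intro mass_distribution[where \<rho> = "1 / Suc n", OF assms(1,2)])
         (auto simp: \<delta>_def E_def field_simps)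
    moreover have "hausdorff_content s \<delta> F \<le> hausdorff_measure s F"
      unfolding hausdorff_measure_def by (intro SUP_upper) (simp add: \<delta>_def)
    ultimately show ?thesis
      using s by auto
  qed
  have "msupport M \<subseteq> (\<Union>n. E n)"
  proof
    fix z assume z: "z \<in> msupport M"
    then have "ereal t < lower_local_dim M z"
      using t(2) by (meson INF_lower less_le_trans)
    then obtain b where b: "0 < b" "\<And>r. 0 < r \<Longrightarrow> r < b \<Longrightarrow> measure M (ball z r) \<le> r powr t"
      using measure_ball_le_powr[OF assms(1) z] by blast
    obtain n where "inverse (real (Suc n)) < b"
      using reals_Archimedean[OF b(1)] by auto
    then have "z \<in> E n"
      using b(2) by (auto simp: E_def inverse_eq_divide)
    then show "z \<in> (\<Union>n. E n)" by auto
  qed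
  then have "F \<subseteq> (\<Union>n. F \<inter> E n) \<union> - msupport M" by auto
  moreover have "(\<Union>n. F \<inter> E n) \<union> - msupport M \<in> null_sets M"
    using null E assms(2-4) closed_msupport[of M]
    by (intro null_sets.Un null_sets_UN) (auto simp: null_sets_def)
  ultimately have "emeasure M F = 0"
    by (metis emeasure_mono le_zero_eq null_setsD1 null_setsD2)
  then show False
    using assms(5) by simp
qed

section \<open>Upper bounds for Hausdorff dimension\<close>

text \<open>The usual countable subadditivity argument: cover the \<open>n\<close>-th set at cost \<open>e / 2\<^sup>n\<^sup>+\<^sup>1\<close> and enumerate
  the double sequence of covering sets.\<close>

lemma hausdorff_content_UN_eq_0:
  fixes F :: "nat \<Rightarrow> 'a::metric_space set"
  assumes "\<And>n. hausdorff_content s \<delta> (F n) = 0"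
  shows "hausdorff_content s \<delta> (\<Union>n. F n) = 0"
proof -
  have le: "hausdorff_content s \<delta> (\<Union>n. F n) \<le> ennreal e" if "0 < e" for e
  proof -
    have "\<exists>U. F n \<subseteq> (\<Union>i. U i) \<and> (\<forall>i. bounded (U i) \<and> diameter (U i) \<le> \<delta>) \<and>
        (\<Sum>i. ennreal (diam_power s (U i))) < ennreal (e * (1/2) ^ Suc n)" for n
    proof -
      have "hausdorff_content s \<delta> (F n) < ennreal (e * (1/2) ^ Suc n)"
        using assms that by simp
      then show ?thesis
        unfolding hausdorff_content_def INF_less_iff by blast
    qed
    then obtain U where U: "\<And>n. F n \<subseteq> (\<Union>i. U n i)"
      "\<And>n i. bounded (U n i)" "\<And>n i. diameter (U n i) \<le> \<delta>"
      "\<And>n. (\<Sum>i. ennreal (diam_power s (U n i))) < ennreal (e * (1/2) ^ Suc n)"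
      by metis
    define V where "V k = (case prod_decode k of (n, i) \<Rightarrow> U n i)" for k
    have "(\<Union>n. F n) \<subseteq> (\<Union>k. V k)"
    proof
      fix x assume "x \<in> (\<Union>n. F n)"
      then obtain n i where "x \<in> U n i"
        using U(1) by blast
      then have "x \<in> V (prod_encode (n, i))"
        by (simp add: V_def)
      then show "x \<in> (\<Union>k. V k)" by blast
    qed
    then have "hausdorff_content s \<delta> (\<Union>n. F n) \<le> (\<Sum>k. ennreal (diam_power s (V k)))"
      unfolding hausdorff_content_def
      by (intro INF_lower) (auto simp: V_def U(2,3) split: prod.split)
    also have "\<dots> = (\<Sum>k. (\<lambda>(n, i). ennreal (diam_power s (U n i))) (prod_decode k))"
      by (simp add: V_def case_prod_beta')
    also have "\<dots> = (\<Sum>n. \<Sum>i. ennreal (diam_power s (U n i)))"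
      by (rule suminf_ennreal_2dimen) simp
    also have "\<dots> \<le> (\<Sum>n. ennreal (e * (1/2) ^ Suc n))"
      using U(4) by (intro suminf_le) (auto intro: less_imp_le)
    also have "\<dots> = ennreal e"
      using sums_mult[OF power_half_series, of e] that
      by (intro suminf_ennreal_eq) auto
    finally show ?thesis .
  qed
  have "hausdorff_content s \<delta> (\<Union>n. F n) \<le> 0"
    by (rule ennreal_le_epsilon) (simp add: le del: le_zero_eq)
  then show ?thesis by simp
qed

lemma hausdorff_content_finite_cover:
  fixes F :: "'a::metric_space set"
  assumes "finite A" "F \<subseteq> (\<Union>a\<in>A. U a)" "0 < s" "0 \<le> \<eta>" "\<eta> \<le> \<delta>"
    and "\<And>a. a \<in> A \<Longrightarrow> bounded (U a)" "\<And>a. a \<in> A \<Longrightarrow> diameter (U a) \<le> \<eta>"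
  shows "hausdorff_content s \<delta> F \<le> ennreal (card A * \<eta> powr s)"
proof -
  obtain h where h: "bij_betw h {0..<card A} A"
    using ex_bij_betw_nat_finite[OF assms(1)] by auto
  define V where "V i = (if i < card A then U (h i) else {})" for i
  have hA: "h i \<in> A" if "i < card A" for i
    using h that by (auto simp: bij_betw_def)
  have V: "bounded (V i)" "diameter (V i) \<le> \<eta>" for i
    using assms(4,6,7) hA by (auto simp: V_def)
  have "F \<subseteq> (\<Union>i. V i)"
  proof
    fix x assume "x \<in> F"
    then obtain a where a: "a \<in> A" "x \<in> U a"
      using assms(2) by auto
    then have "a \<in> h ` {0..<card A}"
      using bij_betw_imp_surj_on[OF h] by simp
    then obtain i where "i < card A" "h i = a"
      by auto
    then have "x \<in> V i"
      using a by (simp add: V_def)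
    then show "x \<in> (\<Union>i. V i)" by auto
  qed
  then have "hausdorff_content s \<delta> F \<le> (\<Sum>i. ennreal (diam_power s (V i)))"
    unfolding hausdorff_content_def
    using V assms(5) by (intro INF_lower) (auto intro: order_trans)
  also have "\<dots> = (\<Sum>i<card A. ennreal (diam_power s (V i)))"
    by (intro suminf_finite) (auto simp: V_def diam_power_def)
  also have "\<dots> \<le> (\<Sum>i<card A. ennreal (\<eta> powr s))"
    using V assms(3) by (intro sum_mono ennreal_leI) (auto simp: diam_power_def diameter_ge_0 intro!: powr_mono2)
  also have "\<dots> = ennreal (card A * \<eta> powr s)"
    by (simp add: ennreal_mult ennreal_of_nat_eq_real_of_nat)
  finally show ?thesis .
qed

lemma packing_card_bound:
  fixes M :: "'a::metric_space measure"
  assumes "finite_measure M" "sets M = sets borel" "finite A"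
    and "\<And>a b. a \<in> A \<Longrightarrow> b \<in> A \<Longrightarrow> a \<noteq> b \<Longrightarrow> 2 * r \<le> dist a b"
    and "\<And>a. a \<in> A \<Longrightarrow> c \<le> measure M (ball a r)"
  shows "real (card A) * c \<le> measure M (space M)"
proof -
  interpret finite_measure M by fact
  have "disjoint_family_on (\<lambda>a. ball a r) A"
    unfolding disjoint_family_on_def
  proof (intro ballI impI)
    fix a b assume "a \<in> A" "b \<in> A" "a \<noteq> b"
    then have "2 * r \<le> dist a b" by fact
    then show "ball a r \<inter> ball b r = {}"
      using disjoint_ballI[of r r a b] by simp
  qed
  then have "measure M (\<Union>a\<in>A. ball a r) = (\<Sum>a\<in>A. measure M (ball a r))"
    using assms by (intro finite_measure_finite_Union) auto
  moreover have "real (card A) * c \<le> (\<Sum>a\<in>A. measure M (ball a r))"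
    using sum_mono[of A "\<lambda>_. c" "\<lambda>a. measure M (ball a r)"] assms(5) by simp
  ultimately show ?thesis
    using bounded_measure[of "\<Union>a\<in>A. ball a r"] by simp
qed

text \<open>A \<open>2 r\<close>-separated subset of \<open>S\<close> has disjoint \<open>r\<close>-balls of mass at least \<open>c\<close>, so its cardinality is
  bounded. Hence one of maximal cardinality exists, and by maximality its \<open>2 r\<close>-balls cover \<open>S\<close>.\<close>

lemma finite_net_exists:
  fixes M :: "'a::metric_space measure"
  assumes "finite_measure M" "sets M = sets borel" "0 < c" "0 < r"
    and "\<And>z. z \<in> S \<Longrightarrow> c \<le> measure M (ball z r)"
  obtains A where "finite A" "S \<subseteq> (\<Union>a\<in>A. ball a (2 * r))" "real (card A) * c \<le> measure M (space M)"
proof -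
  define P where "P A \<longleftrightarrow> finite A \<and> A \<subseteq> S \<and> (\<forall>a\<in>A. \<forall>b\<in>A. a \<noteq> b \<longrightarrow> 2 * r \<le> dist a b)" for A
  have card: "real (card A) * c \<le> measure M (space M)" if "P A" for A
    using that assms(5) by (intro packing_card_bound[OF assms(1,2), of A r]) (auto simp: P_def)
  obtain N where N: "measure M (space M) / c < real N"
    using reals_Archimedean2 by blast
  have bdd: "card A < N" if "P A" for A
  proof -
    have "real (card A) < real N"
      using le_less_trans[OF iffD2[OF pos_le_divide_eq card[OF that]] N] assms(3) by simp
    then show ?thesis by simp
  qed
  have "P {}" by (simp add: P_def)
  then have "\<exists>A. P A \<and> (\<forall>B. P B \<longrightarrow> card B \<le> card A)"
    by (rule ex_has_greatest_nat[where b = N]) (use bdd in auto)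
  then obtain A where A: "P A" "\<And>B. P B \<Longrightarrow> card B \<le> card A"
    by auto
  have "S \<subseteq> (\<Union>a\<in>A. ball a (2 * r))"
  proof (rule ccontr)
    assume "\<not> ?thesis"
    then obtain z where z: "z \<in> S" "\<And>a. a \<in> A \<Longrightarrow> 2 * r \<le> dist a z"
      by (force simp: not_less)
    have "z \<notin> A"
      using z(2) assms(4) by fastforce
    moreover have "P (insert z A)"
      using A(1) z by (auto simp: P_def dist_commute)
    ultimately show False
      using A(2)[of "insert z A"] A(1) by (simp add: P_def)
  qed
  then show ?thesis
    using that A(1) card by (auto simp: P_def)
qed

text \<open>The net at scale \<open>r\<close> has at most \<open>m r\<^sup>-\<^sup>t\<close> points, \<open>m\<close> being the total mass, and its covering balls
  have diameter at most \<open>4 r\<close>. The cost \<open>m 4\<^sup>s r\<^sup>s\<^sup>-\<^sup>t\<close> tends to 0.\<close>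

lemma hausdorff_content_eq_0_of_mass_lower_bound:
  fixes M :: "'a::metric_space measure"
  assumes "finite_measure M" "sets M = sets borel" "t < s" "0 < s" "0 < \<delta>" "0 < \<rho>"
    and bound: "\<And>z r. z \<in> S \<Longrightarrow> 0 < r \<Longrightarrow> r < \<rho> \<Longrightarrow> r powr t \<le> measure M (ball z r)"
  shows "hausdorff_content s \<delta> S = 0"
proof -
  define m where "m = measure M (space M)"
  \<comment> \<open>The bound \<open>\<delta> / 4\<close> on \<open>r\<close> keeps the diameters \<open>4 r\<close> of the covering balls below \<open>\<delta>\<close>.\<close>
  have "hausdorff_content s \<delta> S \<le> ennreal (m * 4 powr s * r powr (s - t))"
    if r: "0 < r" "r < min \<rho> (\<delta> / 4)" for r
  proof -
    obtain A where A: "finite A" "S \<subseteq> (\<Union>a\<in>A. ball a (2 * r))" "real (card A) * r powr t \<le> m"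
      using finite_net_exists[OF assms(1,2), of "r powr t" r S] bound r by (auto simp: m_def)
    have "diameter (ball a (2 * r)) \<le> 4 * r" for a :: 'a
    proof -
      have "dist x y \<le> 4 * r" if "x \<in> ball a (2 * r)" "y \<in> ball a (2 * r)" for x y
        using that dist_triangle3[of x y a] by simp
      then show ?thesis
        unfolding diameter_def using r by (auto intro!: cSUP_least)
    qed
    then have "hausdorff_content s \<delta> S \<le> ennreal (card A * (4 * r) powr s)"
      using A r assms by (intro hausdorff_content_finite_cover) auto
    also have "card A * (4 * r) powr s = (card A * r powr t) * (4 powr s * r powr (s - t))"
      using r by (simp add: powr_mult powr_diff)
    also have "\<dots> \<le> m * (4 powr s * r powr (s - t))"
      using A(3) by (intro mult_right_mono) auto
    finally show ?thesis
      by (simp add: mult.assoc ennreal_leI)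
  qed
  then have "\<forall>\<^sub>F r in at_right 0. hausdorff_content s \<delta> S \<le> ennreal (m * 4 powr s * r powr (s - t))"
    using assms by (auto simp: eventually_at_right_field intro!: exI[of _ "min \<rho> (\<delta> / 4)"])
  moreover have "((\<lambda>r. ennreal (m * 4 powr s * r powr (s - t))) \<longlongrightarrow>
      ennreal (m * 4 powr s * 0 powr (s - t))) (at_right 0)"
    using assms(3) by (intro tendsto_intros tendsto_ennrealI) (auto simp: eventually_at_right_field intro!: exI[of _ 1])
  ultimately have "hausdorff_content s \<delta> S \<le> ennreal (m * 4 powr s * 0 powr (s - t))"
    by (intro tendsto_lowerbound[where F = "at_right 0"]) auto
  then show ?thesis by simp
qed

text \<open>For \<open>s\<close> above the supremum, an exponent \<open>t\<close> in between decomposes the support into countably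
  many pieces of uniform lower mass bound, each of zero \<open>s\<close>-dimensional measure. Nonemptiness of the
  support makes the supremum nonnegative, so that \<open>s\<close> is positive.\<close>

lemma hausdorff_dim_msupport_le:
  fixes M :: "'a::metric_space measure"
  assumes "prob_space M" "sets M = sets borel" "msupport M \<noteq> {}"
  shows "hausdorff_dim (msupport M) \<le> (SUP z\<in>msupport M. upper_local_dim M z)"
    (is "_ \<le> ?u")
proof (rule dense_ge)
  interpret prob_space M by fact
  obtain z0 where z0: "z0 \<in> msupport M"
    using assms(3) by auto
  have u: "0 \<le> ?u"
    using upper_local_dim_nonneg[OF assms(1) z0] SUP_upper[OF z0] by (rule order_trans)
  fix w assume w: "?u < w"
  show "hausdorff_dim (msupport M) \<le> w"
  proof (cases w)
    case (real s)
    then obtain t where t: "?u < ereal t" "t < s"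
      using ereal_dense2[of ?u w] w by auto
    have "0 < t"
      using u t(1) by (metis ereal_less(2) le_less_trans)
    then have s: "0 < s"
      using t(2) by simp
    define E where "E n = {z\<in>msupport M. \<forall>r\<in>{0<..<1 / Suc n}. r powr t \<le> measure M (ball z r)}" for n
    have "msupport M \<subseteq> (\<Union>n. E n)"
    proof
      fix z assume z: "z \<in> msupport M"
      then have "upper_local_dim M z < ereal t"
        using t(1) by (meson SUP_upper le_less_trans)
      then obtain b where b: "0 < b" "\<And>r. 0 < r \<Longrightarrow> r < b \<Longrightarrow> r powr t \<le> measure M (ball z r)"
        using powr_le_measure_ball[OF finite_measure_axioms z] by blast
      obtain n where "inverse (real (Suc n)) < b"
        using reals_Archimedean[OF b(1)] by auto
      then have "z \<in> E n"
        using b(2) z by (auto simp: E_def inverse_eq_divide)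
      then show "z \<in> (\<Union>n. E n)" by auto
    qed
    then have "msupport M = (\<Union>n. E n)"
      by (auto simp: E_def)
    moreover have "hausdorff_content s \<delta> (E n) = 0" if "0 < \<delta>" for \<delta> n
      using t s that
      by (intro hausdorff_content_eq_0_of_mass_lower_bound[OF finite_measure_axioms assms(2), where \<rho> = "1 / Suc n"])
         (auto simp: E_def)
    ultimately have "hausdorff_measure s (msupport M) = 0"
      by (auto simp: hausdorff_measure_def hausdorff_content_UN_eq_0)
    then show ?thesis
      unfolding hausdorff_dim_def real using s by (intro INF_lower) auto
  qed (use w u in auto)
qed

section \<open>The chain of inequalities\<close>

theorem proposition2p12:
  fixes M :: "'a::metric_space measure" and \<Phi> :: "real \<Rightarrow> real"
  assumes "bounded (UNIV :: 'a set)"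
    and "sets M = sets borel"
    and "prob_space M"
    and "emeasure M (- msupport M) = 0"
    and "dimension_function \<Phi>"
  shows "lower_Phi_dim \<Phi> M \<le> (INF z\<in>msupport M. lower_local_dim M z) \<and>
         (INF z\<in>msupport M. lower_local_dim M z) \<le> measure_hausdorff_dim M \<and>
         measure_hausdorff_dim M \<le> (SUP z\<in>msupport M. upper_local_dim M z) \<and>
         (SUP z\<in>msupport M. upper_local_dim M z) \<le> upper_Phi_dim \<Phi> M"
proof (intro conjI)
  interpret prob_space M by fact
  note fin = finite_measure_axioms
  have supp: "msupport M \<in> sets M" "0 < emeasure M (msupport M)"
  proof -
    show sets: "msupport M \<in> sets M"
      using closed_msupport[OF assms(2)] assms(2) by simp
    have "msupport M \<union> - msupport M = space M"
      using sets_eq_imp_space_eq[OF assms(2)] by auto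
    then have "1 \<le> emeasure M (msupport M) + emeasure M (- msupport M)"
      using emeasure_subadditive[OF sets, of "- msupport M"] sets assms(2) emeasure_space_1
      by (simp add: borel_comp)
    then show "0 < emeasure M (msupport M)"
      using assms(4) by (auto simp: zero_less_iff_neq_zero)
  qed
  show "lower_Phi_dim \<Phi> M \<le> (INF z\<in>msupport M. lower_local_dim M z)"
    unfolding lower_Phi_dim_def
    using lower_Phi_exponent_le_local_dim[OF fin assms(5)]
    by (intro SUP_least INF_greatest) auto
  show "(INF z\<in>msupport M. lower_local_dim M z) \<le> measure_hausdorff_dim M"
    unfolding measure_hausdorff_dim_def
    using INF_lower_local_dim_le_hausdorff_dim[OF fin assms(2,4)]
    by (intro INF_greatest) auto
  have "measure_hausdorff_dim M \<le> hausdorff_dim (msupport M)"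
    unfolding measure_hausdorff_dim_def using supp by (intro INF_lower) auto
  also have "\<dots> \<le> (SUP z\<in>msupport M. upper_local_dim M z)"
    using supp(2) by (intro hausdorff_dim_msupport_le[OF assms(3,2)]) auto
  finally show "measure_hausdorff_dim M \<le> (SUP z\<in>msupport M. upper_local_dim M z)" .
  show "(SUP z\<in>msupport M. upper_local_dim M z) \<le> upper_Phi_dim \<Phi> M"
    unfolding upper_Phi_dim_def
    using local_dim_le_upper_Phi_exponent[OF fin assms(5)]
    by (intro SUP_least INF_greatest) auto
qed

end
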